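(* Let $c\ge 2$ and $r\ge 1$ be integers, and let $v$ be the central vertex of $T_{(c-1)^r,r}$, i.e. the common first vertex of its $(c-1)^r$ constituent paths (which has degree $(c-1)^r$). Then $$M_c^{(v)}\bigl(T_{(c-1)^r,r}\bigr)\ \ge\ (c-1)r .$$
   Context: For positive integers $a,b$, $T_{a,b}$ is the tree obtained from the star $K_{1,a}$ by subdividing every edge exactly $b-1$ times; equivalently, $T_{a,b}$ consists of $a$ paths on $b+1$ vertices each, all sharing a common first vertex and otherwise disjoint. The fixed Flood-It game with pivot $v$: let $G=(V,E)$ be a connected graph with a colouring $\omega:V\to C$, not necessarily proper, where $C$ is a finite colour-set. A monochromatic component is a maximal set of vertices of one colour inducing a connected subgraph. A move consists of a colour $d\in C$ and recolours with colour $d$ every vertex in the monochromatic component (with respect to the current colouring) containing the fixed pivot vertex $v$. For $d\in C$, $m^{(v)}(G,\omega,d)$ is the minimum number of such moves needed, starting from $\omega$, to give all vertices of $G$ colour $d$, and $m^{(v)}(G,\omega)=\min_{d\in C}m^{(v)}(G,\omega,d)$. For a positive integer $c\le|V|$, $M_c^{(v)}(G)=\max_\omega m^{(v)}(G,\omega)$, where the maximum is over all surjective colourings $\omega:V\to\{1,\dots,c\}$ (with colour-set $C=\{1,\dots,c\}$). *)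

theory Defs
  imports "Graph_Theory.Digraph_Component" "HOL-Library.FuncSet"
begin

text \<open>Undirected graphs are symmetric digraphs, as in \<^theory>\<open>Graph_Theory.Digraph\<close>;
  \<^const>\<open>connected\<close> includes non-emptiness.\<close>

section \<open>The fixed Flood-It game\<close>

definition mono_connected :: "('a,'b) pre_digraph \<Rightarrow> ('a \<Rightarrow> 'c) \<Rightarrow> 'a set \<Rightarrow> bool" where
  "mono_connected G \<omega> S \<longleftrightarrow>
     S \<subseteq> verts G \<and> (\<exists>d. \<forall>u\<in>S. \<omega> u = d) \<and> connected (G \<restriction> S)"

definition mono_component :: "('a,'b) pre_digraph \<Rightarrow> ('a \<Rightarrow> 'c) \<Rightarrow> 'a set \<Rightarrow> bool" where
  "mono_component G \<omega> S \<longleftrightarrow>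
     mono_connected G \<omega> S \<and> (\<forall>S'. mono_connected G \<omega> S' \<and> S \<subseteq> S' \<longrightarrow> S' = S)"

definition flood_move :: "('a,'b) pre_digraph \<Rightarrow> 'a \<Rightarrow> ('a \<Rightarrow> 'c) \<Rightarrow> 'c \<Rightarrow> ('a \<Rightarrow> 'c)" where
  "flood_move G v \<omega> d =
     (\<lambda>u. if \<exists>S. mono_component G \<omega> S \<and> v \<in> S \<and> u \<in> S then d else \<omega> u)"

text \<open>For a finite connected graph, a pivot \<open>v \<in> verts G\<close>, a finite non-empty colour-set \<open>C\<close>,
  \<open>d \<in> C\<close> and a colouring into \<open>C\<close>, some sequence of moves gives every vertex colour \<open>d\<close>,
  so the least element exists.\<close>

definition flood_number_to ::
    "('a,'b) pre_digraph \<Rightarrow> 'c set \<Rightarrow> 'a \<Rightarrow> ('a \<Rightarrow> 'c) \<Rightarrow> 'c \<Rightarrow> nat" where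
  "flood_number_to G C v \<omega> d =
     (LEAST n. \<exists>ds. length ds = n \<and> set ds \<subseteq> C \<and>
                 (\<forall>u\<in>verts G. foldl (flood_move G v) \<omega> ds u = d))"

definition flood_number :: "('a,'b) pre_digraph \<Rightarrow> 'c set \<Rightarrow> 'a \<Rightarrow> ('a \<Rightarrow> 'c) \<Rightarrow> nat" where
  "flood_number G C v \<omega> = Min (flood_number_to G C v \<omega> ` C)"

definition surj_colourings :: "('a,'b) pre_digraph \<Rightarrow> nat \<Rightarrow> ('a \<Rightarrow> nat) set" where
  "surj_colourings G c = {\<omega> \<in> verts G \<rightarrow>\<^sub>E {1..c}. \<omega> ` verts G = {1..c}}"

definition max_flood_number :: "('a,'b) pre_digraph \<Rightarrow> nat \<Rightarrow> 'a \<Rightarrow> nat" where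
  "max_flood_number G c v = Max (flood_number G {1..c} v ` surj_colourings G c)"

section \<open>The trees obtained by subdividing stars\<close>

datatype tree_vertex = Centre | Leg nat nat

text \<open>Vertex number \<open>j\<close> of path number \<open>i\<close>; all paths share vertex number 0.\<close>

definition path_vertex :: "nat \<Rightarrow> nat \<Rightarrow> tree_vertex" where
  "path_vertex i j = (if j = 0 then Centre else Leg i j)"

definition subdivided_star :: "nat \<Rightarrow> nat \<Rightarrow> tree_vertex pair_pre_digraph" where
  "subdivided_star a b = \<lparr> pverts = {path_vertex i j | i j. i < a \<and> j \<le> b},
             parcs = {(path_vertex i j, path_vertex i (Suc j)) | i j. i < a \<and> j < b}
                   \<union> {(path_vertex i (Suc j), path_vertex i j) | i j. i < a \<and> j < b} \<rparr>"

lemma pair_graph_subdivided_star: "pair_graph (subdivided_star a b)"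
proof -
  have V: "pverts (subdivided_star a b) = (\<lambda>(i, j). path_vertex i j) ` ({..<a} \<times> {..b})"
    by (auto simp: subdivided_star_def image_iff)
  have E: "parcs (subdivided_star a b) = (\<lambda>(i, j). (path_vertex i j, path_vertex i (Suc j))) ` ({..<a} \<times> {..<b})
      \<union> (\<lambda>(i, j). (path_vertex i (Suc j), path_vertex i j)) ` ({..<a} \<times> {..<b})"
    by (auto simp: subdivided_star_def image_iff)
  show ?thesis
  proof
    fix e assume e: "e \<in> parcs (subdivided_star a b)"
    show "fst e \<in> pverts (subdivided_star a b)" "snd e \<in> pverts (subdivided_star a b)"
      using e unfolding subdivided_star_def by fastforce+
    show "fst e \<noteq> snd e"
      using e unfolding subdivided_star_def by (auto simp: path_vertex_def split: if_splits)
  next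
    show "finite (pverts (subdivided_star a b))" "finite (parcs (subdivided_star a b))"
      by (simp_all add: V E)
    show "symmetric (with_proj (subdivided_star a b))"
      by (auto simp: symmetric_def sym_def subdivided_star_def)
  qed
qed

lemma connected_subdivided_star:
  assumes "0 < a"
  shows "connected (with_proj (subdivided_star a b))"
proof -
  interpret pair_graph "subdivided_star a b" by (rule pair_graph_subdivided_star)
  let ?G = "with_proj (subdivided_star a b)"
  have r: "Centre \<rightarrow>\<^sup>*\<^bsub>?G\<^esub> path_vertex i j" if "i < a" "j \<le> b" for i j
    using that(2)
  proof (induction j)
    case 0
    have "path_vertex i 0 \<in> pverts (subdivided_star a b)" using that(1) by (auto simp: subdivided_star_def)
    then show ?case by (simp add: path_vertex_def)
  next
    case (Suc j)
    have "(path_vertex i j, path_vertex i (Suc j)) \<in> parcs (subdivided_star a b)"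
      using Suc.prems that(1) unfolding subdivided_star_def by (simp, metis Suc_le_lessD)
    then show ?case using Suc by (auto intro: reachable_adj_trans)
  qed
  have "u \<rightarrow>\<^sup>*\<^bsub>?G\<^esub> w" if "u \<in> pverts (subdivided_star a b)" "w \<in> pverts (subdivided_star a b)" for u w
  proof -
    have "Centre \<rightarrow>\<^sup>*\<^bsub>?G\<^esub> u" "Centre \<rightarrow>\<^sup>*\<^bsub>?G\<^esub> w"
      using that r by (auto simp: subdivided_star_def)
    then show ?thesis
      by (meson reachable_trans symmetric_reachable sym_arcs)
  qed
  moreover have "pverts (subdivided_star a b) \<noteq> {}" using assms by (auto simp: subdivided_star_def)
  ultimately show ?thesis
    by (intro connectedI) (auto intro: reachable_mk_symmetricI)
qed

lemma card_verts_subdivided_star: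
  assumes "0 < a"
  shows "card (pverts (subdivided_star a b)) = a * b + 1"
proof -
  have "pverts (subdivided_star a b) = insert Centre ((\<lambda>(i, j). Leg i j) ` ({..<a} \<times> {1..b}))"
    (is "?L = ?R")
  proof
    show "?L \<subseteq> ?R" by (auto simp: subdivided_star_def path_vertex_def)
    have "path_vertex 0 0 \<in> ?L" using assms unfolding subdivided_star_def by auto
    moreover have "path_vertex i j \<in> ?L" if "i < a" "j \<le> b" for i j
      using that unfolding subdivided_star_def by auto
    ultimately show "?R \<subseteq> ?L" by (force simp: path_vertex_def)
  qed
  moreover have "inj_on (\<lambda>(i, j). Leg i j) ({..<a} \<times> {1..b})"
    by (auto simp: inj_on_def)
  moreover have "Centre \<notin> (\<lambda>(i, j). Leg i j) ` ({..<a} \<times> {1..b})" by auto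
  ultimately show ?thesis
    by (simp add: card_image card_cartesian_product)
qed

end

theory Submission
  imports Defs "HOL-Library.Sublist"
begin

text \<open>Colour the centre with colour \<open>c\<close> and let the legs carry all \<open>(c - 1) ^ r\<close> colour sequences
  that extend this to a proper colouring. Along one leg a sequence of moves can
  only advance by playing the colours of that leg in order, so it must contain the colour sequence
  of every leg as a subsequence. Greedily choosing, at each step, the colour that the
  moves play latest yields a leg that gains at most one vertex per \<open>c - 1\<close> moves.\<close>

section \<open>Proper colour sequences\<close>

text \<open>Here \<open>x\<close> stands for the colour just before the sequence: the colour of the
  centre at first, and the letter last chosen in recursions.\<close>

definition proper_seqs :: "'c set \<Rightarrow> 'c \<Rightarrow> nat \<Rightarrow> 'c list set" where
  "proper_seqs C x n = {xs. length xs = n \<and> set xs \<subseteq> C \<and> distinct_adj (x # xs)}"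

lemma proper_seqs_0 [simp]: "proper_seqs C x 0 = {[]}"
  by (auto simp: proper_seqs_def)

lemma proper_seqs_Suc:
  "proper_seqs C x (Suc n) = (\<Union>y\<in>C - {x}. (#) y ` proper_seqs C y n)"
  by (auto simp: proper_seqs_def length_Suc_conv image_iff)

lemma finite_proper_seqs: "finite C \<Longrightarrow> finite (proper_seqs C x n)"
  by (induction n arbitrary: x) (auto simp: proper_seqs_Suc)

text \<open>Each letter avoids exactly one element of \<open>C\<close>, namely its predecessor. This
  count is what matches the number of legs of the tree.\<close>

lemma card_proper_seqs:
  assumes "finite C" "x \<in> C"
  shows "card (proper_seqs C x n) = (card C - 1) ^ n"
  using assms(2)
proof (induction n arbitrary: x)
  case (Suc n)
  have "card (proper_seqs C x (Suc n)) = (\<Sum>y\<in>C - {x}. card ((#) y ` proper_seqs C y n))"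
    unfolding proper_seqs_Suc
    using assms(1) by (intro card_UN_disjoint) (auto simp: finite_proper_seqs)
  also have "\<dots> = (\<Sum>y\<in>C - {x}. (card C - 1) ^ n)"
    using Suc.IH by (intro sum.cong) (auto simp: card_image)
  finally show ?case using Suc.prems by simp
qed simp

text \<open>The adversary argument: \<open>card C - 1\<close> letters are admissible next, but
  \<open>card C - 2\<close> moves show at most \<open>card C - 2\<close> colours. Some admissible
  letter is therefore missing there, and matching it consumes at least \<open>card C - 1\<close>
  moves.\<close>

lemma proper_seq_avoiding:
  assumes "finite C" "x \<in> C" "2 \<le> card C"
  shows "\<exists>xs\<in>proper_seqs C x n. subseq xs ds \<longrightarrow> (card C - 1) * n \<le> length ds"
  using assms(2)
proof (induction n arbitrary: x ds)
  case (Suc n)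
  let ?pre = "take (card C - 2) ds" and ?post = "drop (card C - 2) ds"
  have "card (set ?pre) \<le> card C - 2"
    by (rule order.trans[OF card_length]) simp
  moreover have "card (C - {x}) = card C - 1"
    using Suc.prems by simp
  ultimately have "\<not> C - {x} \<subseteq> set ?pre"
    using card_mono[of "set ?pre" "C - {x}"] assms(3) by auto
  then obtain y where y: "y \<in> C - {x}" "y \<notin> set ?pre" by blast
  \<comment> \<open>The \<open>tl\<close> removes the earliest move that can match \<open>y\<close>.
    The default \<open>tl [] = []\<close> does no harm, since \<open>y # ys\<close> does not embed
    into an empty \<open>?post\<close>.\<close>
  obtain ys where ys: "ys \<in> proper_seqs C y n"
      and le: "subseq ys (tl ?post) \<longrightarrow> (card C - 1) * n \<le> length (tl ?post)"
    using Suc.IH[of y "tl ?post"] y by auto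
  have "(card C - 1) * Suc n \<le> length ds" if sub: "subseq (y # ys) ds"
  proof -
    obtain us vs where "y # ys = us @ vs" "subseq us ?pre" "subseq vs ?post"
      using sub subseq_append_iff[of "y # ys" ?pre ?post] by auto
    \<comment> \<open>A nonempty \<open>us\<close> would begin with \<open>y\<close>, which does not
      occur in \<open>?pre\<close>.\<close>
    moreover have "us = []"
      using calculation y(2) by (cases us) (auto dest: list_emb_set)
    ultimately have post: "subseq (y # ys) ?post" by simp
    then obtain z zs where zs: "?post = z # zs" by (cases ?post) auto
    \<comment> \<open>Either \<open>z\<close> matches \<open>y\<close>, or all of
      \<open>y # ys\<close> embeds into \<open>zs\<close>; both cases leave \<open>ys\<close>
      embedded in \<open>zs\<close>.\<close>
    then have "subseq ys zs"
      using post by (auto split: if_splits dest: subseq_Cons')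
    with le zs have "(card C - 1) * n \<le> length zs" by simp
    moreover have "length ds - (card C - 2) = Suc (length zs)"
      using arg_cong[OF zs, of length] by simp
    ultimately show ?thesis using assms(3) unfolding mult_Suc_right by linarith
  qed
  then show ?case using y ys by (auto simp: proper_seqs_Suc)
qed simp

section \<open>Flooding in finite graphs\<close>

text \<open>On a finite vertex set this is exactly the set that a move recolours, described without
  maximality so that a single witness \<open>S\<close> proves membership.\<close>

definition flood_region :: "('a,'b) pre_digraph \<Rightarrow> 'a \<Rightarrow> ('a \<Rightarrow> 'c) \<Rightarrow> 'a set" where
  "flood_region G v \<omega> = {u. \<exists>S. mono_connected G \<omega> S \<and> v \<in> S \<and> u \<in> S}"

text \<open>A walk from inside \<open>A\<close> to outside must use an edge leaving
  \<open>A\<close>. This serves twice: to find a vertex that the flood can absorb next, and to show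
  where a connected set enters a leg.\<close>

lemma connected_crossing:
  assumes "connected H" "u \<in> verts H" "w \<in> verts H" "u \<in> A" "w \<notin> A"
  obtains a b where "a \<in> verts H" "b \<in> verts H" "a \<in> A" "b \<notin> A" "(a, b) \<in> (arcs_ends H)\<^sup>s"
proof -
  have "(u, w) \<in> rtrancl_on (verts H) ((arcs_ends H)\<^sup>s)"
    using assms by (simp add: connected_conv)
  then have "w \<notin> A \<longrightarrow> (\<exists>a b. a \<in> verts H \<and> b \<in> verts H \<and> a \<in> A \<and> b \<notin> A \<and> (a, b) \<in> (arcs_ends H)\<^sup>s)"
  proof (induction rule: rtrancl_on_induct)
    case base
    show ?case using assms(4) by simp
  next
    case (step y z)
    then show ?case by blast
  qed
  with assms(5) that show thesis by blast
qed

lemma arcs_ends_induce_subgraph: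
  "(a, b) \<in> arcs_ends (G \<restriction> S) \<longleftrightarrow> (a, b) \<in> arcs_ends G \<and> a \<in> S \<and> b \<in> S"
  by (auto simp: arcs_ends_conv)

lemma connected_insert:
  assumes "connected (G \<restriction> S)" "a \<in> S" "(a, w) \<in> (arcs_ends G)\<^sup>s"
  shows "connected (G \<restriction> insert w S)"
proof -
  let ?R = "rtrancl_on (insert w S) ((arcs_ends (G \<restriction> insert w S))\<^sup>s)"
  have aw: "(a, w) \<in> ?R" "(w, a) \<in> ?R"
    using assms(2,3)
    by (auto intro!: rtrancl_on_into_rtrancl_on[OF rtrancl_on_refl]
        simp: symcl_def arcs_ends_induce_subgraph)
  have S: "(x, y) \<in> ?R" if "x \<in> S" "y \<in> S" for x y
  proof -
    have "(x, y) \<in> rtrancl_on S ((arcs_ends (G \<restriction> S))\<^sup>s)"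
      using assms(1) that by (simp add: connected_conv)
    then show ?thesis
      by (rule rtrancl_on_mono[rotated 2]) (auto simp: symcl_def arcs_ends_induce_subgraph)
  qed
  \<comment> \<open>All connections are routed through the attachment vertex
    \<open>a\<close>.\<close>
  have "(x, y) \<in> ?R" if "x \<in> insert w S" "y \<in> insert w S" for x y
  proof -
    have "(x, a) \<in> ?R" "(a, y) \<in> ?R"
      using that aw S assms(2) by auto
    then show ?thesis by (rule rtrancl_on_trans)
  qed
  then show ?thesis by (simp add: connected_conv)
qed

lemma mono_component_exists:
  assumes "finite (verts G)" "mono_connected G \<omega> S"
  obtains T where "mono_component G \<omega> T" "S \<subseteq> T"
proof -
  have "finite {T. mono_connected G \<omega> T}"
    by (rule finite_subset[of _ "Pow (verts G)"]) (auto simp: mono_connected_def assms(1))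
  from finite_has_maximal2[OF this, of S] assms(2) obtain T where
    "mono_connected G \<omega> T" "S \<subseteq> T" "\<forall>T'. mono_connected G \<omega> T' \<longrightarrow> T \<subseteq> T' \<longrightarrow> T = T'"
    by auto
  then show thesis by (intro that[of T]) (auto simp: mono_component_def)
qed

lemma flood_move_eq:
  assumes "finite (verts G)"
  shows "flood_move G v \<omega> d = (\<lambda>u. if u \<in> flood_region G v \<omega> then d else \<omega> u)"
proof -
  have "(\<exists>S. mono_component G \<omega> S \<and> v \<in> S \<and> u \<in> S) \<longleftrightarrow> u \<in> flood_region G v \<omega>" for u
  proof
    assume "u \<in> flood_region G v \<omega>"
    then obtain S where S: "mono_connected G \<omega> S" "v \<in> S" "u \<in> S"
      by (auto simp: flood_region_def)
    obtain T where "mono_component G \<omega> T" "S \<subseteq> T"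
      using mono_component_exists[OF assms S(1)] .
    with S show "\<exists>S. mono_component G \<omega> S \<and> v \<in> S \<and> u \<in> S" by blast
  qed (auto simp: flood_region_def mono_component_def)
  then show ?thesis by (simp add: flood_move_def)
qed

lemma pivot_in_flood_region:
  assumes "v \<in> verts G"
  shows "v \<in> flood_region G v \<omega>"
proof -
  have "mono_connected G \<omega> {v}"
    using assms by (simp add: mono_connected_def connected_conv)
  then show ?thesis unfolding flood_region_def by blast
qed

lemma mono_connected_flood_move:
  assumes "finite (verts G)" "mono_connected G \<omega> S" "v \<in> S"
  shows "mono_connected G (flood_move G v \<omega> d) S"
proof -
  have "\<forall>u\<in>S. flood_move G v \<omega> d u = d"
    using assms by (auto simp: flood_move_eq flood_region_def)
  then show ?thesis using assms(2) by (auto simp: mono_connected_def)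
qed

lemma flood_region_mono:
  assumes "finite (verts G)"
  shows "flood_region G v \<omega> \<subseteq> flood_region G v (flood_move G v \<omega> d)"
proof
  fix u assume "u \<in> flood_region G v \<omega>"
  then obtain S where S: "mono_connected G \<omega> S" "v \<in> S" "u \<in> S"
    by (auto simp: flood_region_def)
  then show "u \<in> flood_region G v (flood_move G v \<omega> d)"
    using mono_connected_flood_move[OF assms S(1,2)] unfolding flood_region_def by blast
qed

text \<open>The move gives the region the colour that \<open>w\<close> already has, so a witness set
  for \<open>a\<close> stays monochromatic and connected when \<open>w\<close> is added.\<close>

lemma flood_region_neighbour:
  assumes "finite (verts G)" "a \<in> flood_region G v \<omega>" "w \<in> verts G" "(a, w) \<in> (arcs_ends G)\<^sup>s"
  shows "w \<in> flood_region G v (flood_move G v \<omega> (\<omega> w))"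
proof -
  obtain S where S: "mono_connected G \<omega> S" "v \<in> S" "a \<in> S"
    using assms(2) by (auto simp: flood_region_def)
  have "\<forall>u\<in>insert w S. flood_move G v \<omega> (\<omega> w) u = \<omega> w"
    using S assms(1) by (auto simp: flood_move_eq flood_region_def)
  moreover have "connected (G \<restriction> insert w S)"
    using S assms(4) by (auto simp: mono_connected_def intro: connected_insert)
  ultimately have "mono_connected G (flood_move G v \<omega> (\<omega> w)) (insert w S)"
    using S assms(3) by (auto simp: mono_connected_def)
  then show ?thesis using S(2) by (auto simp: flood_region_def)
qed

text \<open>Ensures that the \<open>LEAST\<close> in \<open>flood_number_to\<close> ranges over a
  nonempty set; otherwise bounding every successful sequence would say nothing about its value.
  While some vertex lies outside the region, playing the colour of an adjacent one strictly shrinks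
  the outside.\<close>

lemma flooding_exists:
  assumes "finite (verts G)" "connected G" "v \<in> verts G" "d \<in> C" "\<omega> ` verts G \<subseteq> C"
  shows "\<exists>ds. set ds \<subseteq> C \<and> (\<forall>u\<in>verts G. foldl (flood_move G v) \<omega> ds u = d)"
  using assms(5)
proof (induction "card (verts G - flood_region G v \<omega>)" arbitrary: \<omega> rule: less_induct)
  case less
  show ?case
  proof (cases "verts G \<subseteq> flood_region G v \<omega>")
    case True
    then have "\<forall>u\<in>verts G. foldl (flood_move G v) \<omega> [d] u = d"
      using assms(1) by (auto simp: flood_move_eq)
    with assms(4) show ?thesis by (intro exI[of _ "[d]"]) auto
  next
    case False
    then obtain u where "u \<in> verts G" "u \<notin> flood_region G v \<omega>" by blast
    then obtain a w where w: "w \<in> verts G" "a \<in> flood_region G v \<omega>" "w \<notin> flood_region G v \<omega>"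
        "(a, w) \<in> (arcs_ends G)\<^sup>s"
      using connected_crossing[OF assms(2,3) _ pivot_in_flood_region[OF assms(3)]] by metis
    let ?\<omega> = "flood_move G v \<omega> (\<omega> w)"
    have "verts G - flood_region G v ?\<omega> \<subset> verts G - flood_region G v \<omega>"
      using flood_region_mono[OF assms(1), of v \<omega> "\<omega> w"]
        flood_region_neighbour[OF assms(1) w(2,1,4)] w(1,3) by blast
    then have "card (verts G - flood_region G v ?\<omega>) < card (verts G - flood_region G v \<omega>)"
      using assms(1) by (intro psubset_card_mono) auto
    moreover have "?\<omega> ` verts G \<subseteq> C"
      using less.prems w(1) assms(1) by (auto simp: flood_move_eq)
    ultimately obtain ds where "set ds \<subseteq> C" "\<forall>u\<in>verts G. foldl (flood_move G v) ?\<omega> ds u = d"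
      using less.hyps by blast
    then show ?thesis
      using less.prems w(1) by (intro exI[of _ "\<omega> w # ds"]) auto
  qed
qed

lemma flood_number_geI:
  assumes "finite (verts G)" "connected G" "v \<in> verts G" "finite C" "C \<noteq> {}" "\<omega> ` verts G \<subseteq> C"
    and bound: "\<And>d ds. \<forall>u\<in>verts G. foldl (flood_move G v) \<omega> ds u = d \<Longrightarrow> n \<le> length ds"
  shows "n \<le> flood_number G C v \<omega>"
proof -
  have "n \<le> flood_number_to G C v \<omega> d" if "d \<in> C" for d
  proof -
    have "\<exists>m ds. length ds = m \<and> set ds \<subseteq> C \<and> (\<forall>u\<in>verts G. foldl (flood_move G v) \<omega> ds u = d)"
      using flooding_exists[OF assms(1-3) that assms(6)] by blast
    from LeastI_ex[OF this] show ?thesis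
      unfolding flood_number_to_def using bound by metis
  qed
  then show ?thesis
    using assms(4,5) by (simp add: flood_number_def)
qed

section \<open>Flooding subdivided stars\<close>

lemma path_vertex_in_verts [simp]: "i < a \<Longrightarrow> j \<le> b \<Longrightarrow> path_vertex i j \<in> pverts (subdivided_star a b)"
  by (auto simp: subdivided_star_def)

lemma Centre_in_verts: "0 < a \<Longrightarrow> Centre \<in> pverts (subdivided_star a b)"
  using path_vertex_in_verts[of 0 a 0 b] by (simp add: path_vertex_def)

lemma finite_verts_subdivided_star: "finite (pverts (subdivided_star a b))"
proof -
  interpret pair_graph "subdivided_star a b" by (rule pair_graph_subdivided_star)
  show ?thesis by (rule pair_finite_verts)
qed

text \<open>An edge joins consecutive positions of one leg, so the part of leg \<open>i\<close>
  beyond position \<open>k\<close> has a single entrance.\<close>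

lemma leg_entry:
  assumes "(u, w) \<in> (arcs_ends (with_proj (subdivided_star a b)))\<^sup>s"
    and "u \<notin> {Leg i j | j. k < j}" "w \<in> {Leg i j | j. k < j}"
  shows "w = Leg i (Suc k)"
proof -
  have "(u, w) \<in> parcs (subdivided_star a b) \<or> (w, u) \<in> parcs (subdivided_star a b)"
    using assms(1) by (auto simp: symcl_def)
  then obtain i' j' where "u = path_vertex i' j' \<and> w = path_vertex i' (Suc j')
      \<or> w = path_vertex i' j' \<and> u = path_vertex i' (Suc j')"
    unfolding subdivided_star_def by auto
  then show ?thesis
    using assms(2,3) by (auto simp: path_vertex_def split: if_splits)
qed

text \<open>A connected set joining the centre to a vertex beyond \<open>k\<close> contains the
  entrance \<open>Leg i (Suc k)\<close>, whose colour differs from that of the centre.\<close>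

lemma flood_region_blocked:
  assumes "\<omega> (Leg i (Suc k)) \<noteq> \<omega> Centre" "k < j"
  shows "Leg i j \<notin> flood_region (with_proj (subdivided_star a b)) Centre \<omega>"
proof
  let ?G = "with_proj (subdivided_star a b)"
  assume "Leg i j \<in> flood_region ?G Centre \<omega>"
  then obtain S where S: "mono_connected ?G \<omega> S" "Centre \<in> S" "Leg i j \<in> S"
    by (auto simp: flood_region_def)
  then have "connected (?G \<restriction> S)" by (simp add: mono_connected_def)
  \<comment> \<open>The cut is taken at the complement of the tail, so the edge found leads into the
    tail.\<close>
  then obtain u w where "w \<in> verts (?G \<restriction> S)" "u \<in> - {Leg i j | j. k < j}"
      "w \<notin> - {Leg i j | j. k < j}" and uw: "(u, w) \<in> (arcs_ends (?G \<restriction> S))\<^sup>s"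
    by (rule connected_crossing[of _ Centre "Leg i j" "- {Leg i j | j. k < j}"])
      (use S assms(2) in auto)
  then have w: "w \<in> S" "u \<notin> {Leg i j | j. k < j}" "w \<in> {Leg i j | j. k < j}"
    by simp_all
  have "(u, w) \<in> (arcs_ends ?G)\<^sup>s"
    using uw by (auto simp: symcl_def arcs_ends_induce_subgraph)
  from leg_entry[OF this w(2,3)] w(1) have "Leg i (Suc k) \<in> S" by simp
  then have "\<omega> (Leg i (Suc k)) = \<omega> Centre"
    using S by (auto simp: mono_connected_def)
  with assms(1) show False by simp
qed

text \<open>Invariant for induction over the moves: on leg \<open>i\<close> the flood reaches at
  most position \<open>k\<close>, and everything beyond has its original colour. Positions count
  from 1 and list indices from 0, so \<open>xs ! k\<close> is the colour of the next vertex,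
  \<open>Leg i (Suc k)\<close>.\<close>

lemma flooding_subseq:
  assumes "i < a" "length xs = b" "distinct_adj xs" "k \<le> b"
    and "\<And>j. k < j \<Longrightarrow> j \<le> b \<Longrightarrow> \<omega> (Leg i j) = xs ! (j - 1)"
    and "k < b \<Longrightarrow> \<omega> Centre \<noteq> xs ! k"
    and "\<forall>u\<in>pverts (subdivided_star a b).
           foldl (flood_move (with_proj (subdivided_star a b)) Centre) \<omega> ds u = d"
  shows "subseq (drop k xs) ds"
  using assms(4-)
proof (induction ds arbitrary: k \<omega>)
  case Nil
  have "\<not> k < b"
  proof
    assume k: "k < b"
    then have "Leg i (Suc k) \<in> pverts (subdivided_star a b)"
      using assms(1) path_vertex_in_verts[of i a "Suc k" b] by (simp add: path_vertex_def)
    then have "\<omega> (Leg i (Suc k)) = \<omega> Centre"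
      using Nil.prems(4) Centre_in_verts assms(1) by auto
    with k Nil.prems show False by simp
  qed
  then show ?case using assms(2) by simp
next
  case (Cons e ds)
  let ?G = "with_proj (subdivided_star a b)"
  let ?\<omega> = "flood_move ?G Centre \<omega> e"
  show ?case
  proof (cases "k < b")
    case True
    have fin: "finite (verts ?G)" by (simp add: finite_verts_subdivided_star)
    have "\<omega> (Leg i (Suc k)) \<noteq> \<omega> Centre"
      using Cons.prems True by simp
    from flood_region_blocked[OF this]
    have legs: "?\<omega> (Leg i j) = xs ! (j - 1)" if "k < j" "j \<le> b" for j
      using that Cons.prems(2) by (simp add: flood_move_eq[OF fin])
    have centre: "?\<omega> Centre = e"
      using Centre_in_verts assms(1) by (simp add: flood_move_eq[OF fin] pivot_in_flood_region)
    have fold: "\<forall>u\<in>pverts (subdivided_star a b). foldl (flood_move ?G Centre) ?\<omega> ds u = d"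
      using Cons.prems(4) by simp
    show ?thesis
    proof (cases "e = xs ! k")
      case eq: True
      \<comment> \<open>The bound advances by just one position: as \<open>xs\<close> is proper, the
        new centre colour \<open>xs ! k\<close> differs from the colour after it.\<close>
      have "subseq (drop (Suc k) xs) ds"
        by (rule Cons.IH[OF _ _ _ fold])
          (use True legs centre eq assms(2) distinct_adj_nth[OF assms(3)] in auto)
      moreover have "drop k xs = e # drop (Suc k) xs"
        using True assms(2) eq by (simp add: Cons_nth_drop_Suc)
      ultimately show ?thesis by simp
    next
      case False
      \<comment> \<open>A move of another colour leaves the next vertex blocked, so the invariant
        persists with the same \<open>k\<close>.\<close>
      have "subseq (drop k xs) ds"
        by (rule Cons.IH[OF _ _ _ fold]) (use True legs centre False in auto)
      then show ?thesis by auto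
    qed
  qed (use assms(2) in simp)
qed

text \<open>The restriction to the vertex set makes the function extensional, as
  \<open>surj_colourings\<close> demands.\<close>

definition leg_colouring :: "(nat \<Rightarrow> nat list) \<Rightarrow> nat \<Rightarrow> nat \<Rightarrow> nat \<Rightarrow> tree_vertex \<Rightarrow> nat" where
  "leg_colouring f x a b = (\<lambda>u\<in>pverts (subdivided_star a b).
     case u of Centre \<Rightarrow> x | Leg i j \<Rightarrow> f i ! (j - 1))"

lemma leg_colouring_Centre: "0 < a \<Longrightarrow> leg_colouring f x a b Centre = x"
  by (simp add: leg_colouring_def Centre_in_verts)

lemma leg_colouring_Leg:
  "i < a \<Longrightarrow> 0 < j \<Longrightarrow> j \<le> b \<Longrightarrow> leg_colouring f x a b (Leg i j) = f i ! (j - 1)"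
  using path_vertex_in_verts[of i a j b] by (simp add: leg_colouring_def path_vertex_def)

text \<open>The invariant starts at \<open>k = 0\<close>: the letter \<open>x\<close> in front of
  the proper sequence is the centre colour, so the first leg vertex is blocked.\<close>

lemma leg_colouring_flooding_subseq:
  assumes "i < a" "f i \<in> proper_seqs C x b"
    and "\<forall>u\<in>pverts (subdivided_star a b).
           foldl (flood_move (with_proj (subdivided_star a b)) Centre) (leg_colouring f x a b) ds u = d"
  shows "subseq (f i) ds"
proof -
  have xs: "length (f i) = b" "distinct_adj (x # f i)"
    using assms(2) by (auto simp: proper_seqs_def)
  have "subseq (drop 0 (f i)) ds"
  proof (rule flooding_subseq[OF assms(1) xs(1) _ _ _ _ assms(3)])
    show "distinct_adj (f i)" using xs(2) by (rule distinct_adj_ConsD)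
    show "leg_colouring f x a b Centre \<noteq> f i ! 0" if "0 < b"
      using that xs assms(1) by (cases "f i") (auto simp: leg_colouring_Centre)
  qed (use assms(1) leg_colouring_Leg in auto)
  then show ?thesis by simp
qed

text \<open>The centre shows \<open>x\<close>; any other colour begins some proper sequence and so
  appears at position 1 of a leg.\<close>

lemma leg_colouring_surj:
  assumes "2 \<le> c" "0 < b" "0 < a" "x \<in> {1..c}" "f ` {..<a} = proper_seqs {1..c} x b"
  shows "leg_colouring f x a b \<in> surj_colourings (with_proj (subdivided_star a b)) c"
proof -
  let ?V = "pverts (subdivided_star a b)" and ?\<omega> = "leg_colouring f x a b"
  have range: "?\<omega> u \<in> {1..c}" if "u \<in> ?V" for u
  proof -
    obtain i j where u: "u = path_vertex i j" "i < a" "j \<le> b"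
      using \<open>u \<in> ?V\<close> unfolding subdivided_star_def by (simp, blast)
    show ?thesis
    proof (cases "j = 0")
      case True
      then show ?thesis using u assms(3,4) by (simp add: path_vertex_def leg_colouring_Centre)
    next
      case False
      have "f i \<in> proper_seqs {1..c} x b" using assms(5) u(2) by blast
      then have "length (f i) = b" "set (f i) \<subseteq> {1..c}" by (simp_all add: proper_seqs_def)
      moreover from this have "f i ! (j - 1) \<in> set (f i)"
        using False u(3) by (intro nth_mem) simp
      ultimately have "f i ! (j - 1) \<in> {1..c}" by blast
      then show ?thesis
        using False u by (simp add: path_vertex_def leg_colouring_Leg)
    qed
  qed
  have "y \<in> ?\<omega> ` ?V" if y: "y \<in> {1..c}" for y
  proof (cases "y = x")
    case True
    then show ?thesis
      using assms(3) Centre_in_verts leg_colouring_Centre by (metis image_eqI)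
  next
    case False
    \<comment> \<open>The count is a power of \<open>c - 1\<close>, positive because
      \<open>2 \<le> c\<close>; thus \<open>y\<close> can be continued to a proper sequence of
      length \<open>b\<close>.\<close>
    have "card (proper_seqs {1..c} y (b - 1)) \<noteq> 0"
      using card_proper_seqs[of "{1..c}" y "b - 1"] y assms(1) by simp
    then obtain ys where "ys \<in> proper_seqs {1..c} y (b - 1)"
      by (metis card.empty ex_in_conv)
    then have "y # ys \<in> proper_seqs {1..c} x b"
      using proper_seqs_Suc[of "{1..c}" x "b - 1"] assms(2) y False by auto
    then obtain i where i: "i < a" "f i = y # ys"
      using assms(5) by (metis imageE lessThan_iff)
    have "Leg i 1 \<in> ?V"
      using i(1) assms(2) path_vertex_in_verts[of i a 1 b] by (simp add: path_vertex_def)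
    moreover have "?\<omega> (Leg i 1) = y"
      using i assms(2) by (simp add: leg_colouring_Leg)
    ultimately show ?thesis by (metis image_eqI)
  qed
  with range have "?\<omega> ` ?V = {1..c}" by blast
  moreover have "?\<omega> \<in> ?V \<rightarrow>\<^sub>E {1..c}"
    using range by (auto simp: leg_colouring_def)
  ultimately show ?thesis by (simp add: surj_colourings_def)
qed

lemma flood_number_le_max_flood_number:
  assumes "finite (verts G)" "\<omega> \<in> surj_colourings G c"
  shows "flood_number G {1..c} v \<omega> \<le> max_flood_number G c v"
proof -
  have "finite (surj_colourings G c)"
    by (rule finite_subset[OF _ finite_PiE[OF assms(1), of "\<lambda>_. {1..c}"]])
      (auto simp: surj_colourings_def)
  with assms(2) show ?thesis by (simp add: max_flood_number_def)
qed

theorem lemma2p13: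
  fixes c r :: nat
  assumes "2 \<le> c" and "1 \<le> r"
  shows "(c - 1) * r \<le> max_flood_number (with_proj (subdivided_star ((c - 1) ^ r) r)) c Centre"
proof -
  let ?a = "(c - 1) ^ r"
  let ?G = "with_proj (subdivided_star ?a r)"
  let ?P = "proper_seqs {1..c} c r"
  have a: "0 < ?a" using assms(1) by simp
  have "card ?P = ?a" using card_proper_seqs[of "{1..c}" c r] assms(1) by simp
  \<comment> \<open>There are as many legs as proper sequences, so every sequence is carried by some
    leg.\<close>
  then obtain f where f: "f ` {..<?a} = ?P"
    using ex_bij_betw_nat_finite[OF finite_proper_seqs[of "{1..c}" c r]]
    by (auto simp: bij_betw_def atLeast0LessThan)
  let ?\<omega> = "leg_colouring f c ?a r"
  have fin: "finite (verts ?G)" by (simp add: finite_verts_subdivided_star)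
  have surj: "?\<omega> \<in> surj_colourings ?G c"
    using assms a f by (intro leg_colouring_surj) auto
  have "(c - 1) * r \<le> flood_number ?G {1..c} Centre ?\<omega>"
  proof (rule flood_number_geI)
    fix d ds
    assume flooded: "\<forall>u\<in>verts ?G. foldl (flood_move ?G Centre) ?\<omega> ds u = d"
    \<comment> \<open>The hard sequence depends on \<open>ds\<close>, which is why a leg for each
      proper sequence is present.\<close>
    obtain xs where xs: "xs \<in> ?P" "subseq xs ds \<longrightarrow> (c - 1) * r \<le> length ds"
      using proper_seq_avoiding[of "{1..c}" c r ds] assms(1) by auto
    then obtain i where "i < ?a" "f i = xs" using f by (metis imageE lessThan_iff)
    then have "subseq xs ds"
      using leg_colouring_flooding_subseq[of i ?a f "{1..c}" c r ds d] xs(1) flooded by simp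
    with xs(2) show "(c - 1) * r \<le> length ds" by blast
  qed (use fin surj a assms(1) in
      \<open>auto simp: connected_subdivided_star Centre_in_verts surj_colourings_def\<close>)
  also have "\<dots> \<le> max_flood_number ?G c Centre"
    by (rule flood_number_le_max_flood_number[OF fin surj])
  finally show ?thesis .
qed

end
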